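(* If $n,m$ are integers with $n\geq m\geq 3$, then $\xi^*_{n,m}>\xi_{n,m}$.
   Context: Let $X$ be a finite alphabet with $n\ge 2$ letters. A code with length distribution $L=(a_1,\ldots,a_m)$, where the $a_i$ are positive integers, is a finite sequence $(v_1,\ldots,v_m)$ of words $v_i\in X^*$ with $|v_i|=a_i$ for all $i$. A code is a prefix code if it is an injective sequence of non-empty words such that no $v_i$ is a prefix (initial segment) of another code word $v_j$, $j\ne i$. A code $(v_1,\ldots,v_m)$ is uniquely decodable if $v_{i_1}v_{i_2}\cdots v_{i_t}=v_{j_1}v_{j_2}\cdots v_{j_{t'}}$ with $t,t'\geq 1$ and all indices in $\{1,\ldots,m\}$ implies $t=t'$ and $i_s=j_s$ for every $1\leq s\leq t$. $UD_n(L)$ denotes the set of uniquely decodable codes over an $n$-letter alphabet with length distribution $L$, and $PR_n(L)\subseteq UD_n(L)$ the subset of prefix codes. $\mathcal{L}_{n,m}$ is the set of sequences $L$ of positive integers of length $|L|=m$ with $UD_n(L)\neq\emptyset$ (equivalently, by Kraft-McMillan, $PR_n(L)\ne\emptyset$, equivalently $\sum_{i=1}^m n^{-a_i}\leq 1$). $\mathcal{L}^*_{n,m}\subseteq\mathcal{L}_{n,m}$ is the subset of injective sequences (all values in $L$ are distinct). Define $$\xi_{n,m}:=\inf_{L\in\mathcal{L}_{n,m}}\frac{|PR_n(L)|}{|UD_n(L)|},\qquad \xi^*_{n,m}:=\inf_{L\in\mathcal{L}^*_{n,m}}\frac{|PR_n(L)|}{|UD_n(L)|}.$$ *)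

theory Defs
  imports Complex_Main "HOL-Library.Sublist"
begin

text \<open>
  The quantities \<open>\<xi>\<close> and \<open>\<xi>\<^sup>*\<close> are indexed by an alphabet \<open>X\<close> instead of by its number of
  letters \<open>n = card X\<close>. A code \<open>(v\<^sub>1, \<dots>, v\<^sub>m)\<close> is a list of words, indexed from 0.
\<close>

definition codes :: "'a set \<Rightarrow> nat list \<Rightarrow> 'a list list set" where
  "codes X L = {vs. vs \<in> lists (lists X) \<and> map length vs = L}"

definition prefix_code :: "'a list list \<Rightarrow> bool" where
  "prefix_code vs \<longleftrightarrow> distinct vs \<and> [] \<notin> set vs \<and>
     (\<forall>i<length vs. \<forall>j<length vs. i \<noteq> j \<longrightarrow> \<not> prefix (vs ! i) (vs ! j))"

definition uniquely_decodable :: "'a list list \<Rightarrow> bool" where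
  "uniquely_decodable vs \<longleftrightarrow>
     (\<forall>is js. is \<noteq> [] \<and> js \<noteq> [] \<and> set is \<subseteq> {..<length vs} \<and> set js \<subseteq> {..<length vs} \<and>
        concat (map (\<lambda>i. vs ! i) is) = concat (map (\<lambda>j. vs ! j) js) \<longrightarrow> is = js)"

definition UD :: "'a set \<Rightarrow> nat list \<Rightarrow> 'a list list set" where
  "UD X L = {vs \<in> codes X L. uniquely_decodable vs}"

definition PR :: "'a set \<Rightarrow> nat list \<Rightarrow> 'a list list set" where
  "PR X L = {vs \<in> codes X L. prefix_code vs}"

definition LD :: "'a set \<Rightarrow> nat \<Rightarrow> nat list set" where
  "LD X m = {L. length L = m \<and> (\<forall>a\<in>set L. 0 < a) \<and> UD X L \<noteq> {}}"

definition LD_star :: "'a set \<Rightarrow> nat \<Rightarrow> nat list set" where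
  "LD_star X m = {L \<in> LD X m. distinct L}"

definition xi :: "'a set \<Rightarrow> nat \<Rightarrow> real" where
  "xi X m = (INF L\<in>LD X m. real (card (PR X L)) / real (card (UD X L)))"

definition xi_star :: "'a set \<Rightarrow> nat \<Rightarrow> real" where
  "xi_star X m = (INF L\<in>LD_star X m. real (card (PR X L)) / real (card (UD X L)))"

lemma finite_codes:
  assumes "finite X"
  shows "finite (codes X L)"
proof (rule finite_subset)
  let ?W = "{w. set w \<subseteq> X \<and> length w \<le> sum_list L}"
  show "codes X L \<subseteq> {vs. set vs \<subseteq> ?W \<and> length vs \<le> length L}"
    by (auto simp: codes_def lists_eq_set intro!: member_le_sum_list)
  show "finite {vs. set vs \<subseteq> ?W \<and> length vs \<le> length L}"
    using assms by (intro finite_lists_length_le)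
qed

lemma prefix_code_imp_uniquely_decodable:
  assumes pc: "prefix_code vs"
  shows "uniquely_decodable vs"
proof -
  have ne: "vs ! i \<noteq> []" if "i < length vs" for i
    using pc that nth_mem unfolding prefix_code_def by metis
  have "is = js"
    if "set is \<subseteq> {..<length vs}" "set js \<subseteq> {..<length vs}"
      "concat (map (\<lambda>i. vs ! i) is) = concat (map (\<lambda>j. vs ! j) js)" for "is" js
    using that
  proof (induction "is" arbitrary: js)
    case Nil
    then show ?case using ne by (cases js) auto
  next
    case (Cons i "is")
    then obtain j js' where js: "js = j # js'"
      using ne by (cases js) auto
    have eq: "vs ! i @ concat (map (\<lambda>i. vs ! i) is) = vs ! j @ concat (map (\<lambda>j. vs ! j) js')"
      using Cons.prems js by simp
    then have "prefix (vs ! i) (vs ! j) \<or> prefix (vs ! j) (vs ! i)"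
      by (metis prefixI prefix_same_cases)
    then have "i = j"
      using pc Cons.prems js unfolding prefix_code_def by auto
    then show ?case using Cons.IH[of js'] Cons.prems js eq by auto
  qed
  then show ?thesis unfolding uniquely_decodable_def by blast
qed

lemma PR_subset_UD: "PR X L \<subseteq> UD X L"
  by (auto simp: PR_def UD_def prefix_code_imp_uniquely_decodable)

lemma xi_bdd_below:
  "bdd_below ((\<lambda>L. real (card (PR X L)) / real (card (UD X L))) ` A)"
  by (rule bdd_belowI[of _ 0]) auto

end

theory Submission
  imports Defs
begin

text \<open>
  For \<open>L = (1, \<dots>, 1, a)\<close> with \<open>m - 1\<close> ones, a code consisting of distinct letters \<open>B\<close> and a
  word \<open>w\<close> is uniquely decodable as soon as \<open>w\<close> contains a letter outside \<open>B\<close>, whereas it is a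
  prefix code only if the first letter of \<open>w\<close> lies outside \<open>B\<close>. Letting \<open>a\<close> tend to infinity
  gives \<open>\<xi> \<le> (n - m + 1) / n\<close>. For pairwise distinct lengths, choosing the code words greedily by
  increasing length yields at least a fraction \<open>\<Prod>i<m. 1 - (n\<^sup>-\<^sup>1 + \<dots> + n\<^sup>-\<^sup>i)\<close> of all codes as prefix
  codes, and this constant exceeds \<open>(n - m + 1) / n\<close>, because each inner sum is less than
  \<open>1 / (n - 1)\<close>.
\<close>

section \<open>Numerical estimates for the greedy product\<close>

text \<open>The r-th smallest element of a set of positive integers is at least r, so an
  antimonotone \<open>f\<close> can be compared term by term. Adding the elements in increasing
  order makes this an induction on the maximum.\<close>

lemma sum_antimono_le_initial_segment:
  fixes f :: "nat \<Rightarrow> real"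
  assumes "antimono f" and "finite S" and "\<forall>s\<in>S. 0 < s"
  shows "sum f S \<le> (\<Sum>j=1..card S. f j)"
  using assms(2,3)
proof (induction S rule: finite_linorder_max_induct)
  case empty
  then show ?case by simp
next
  case (insert b A)
  have "b \<notin> A" using insert by auto
  have "A \<subseteq> {1..<b}" using insert by (auto simp: Suc_le_eq)
  then have "card A \<le> card {1..<b}" by (intro card_mono) auto
  moreover have "0 < b" using insert by auto
  ultimately have "Suc (card A) \<le> b" by auto
  then have "f b \<le> f (Suc (card A))" using assms(1) by (simp add: antimonoD)
  then show ?case using insert \<open>b \<notin> A\<close> by simp
qed

text \<open>Factor \<open>i\<close> is the guaranteed fraction of admissible words once
  \<open>i\<close> shorter code words are chosen. The worst case is that these have lengths 1 to
  \<open>i\<close>.\<close>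

definition greedy_bound :: "nat \<Rightarrow> nat \<Rightarrow> real" where
  "greedy_bound n k = (\<Prod>i<k. 1 - (\<Sum>j=1..i. 1 / real n ^ j))"

lemma geometric_sum_less:
  assumes "2 \<le> n"
  shows "(\<Sum>j=1..i. 1 / real n ^ j) < 1 / (real n - 1)"
proof -
  have "(\<Sum>j=1..i. 1 / real n ^ j) = 1 / (real n - 1) - 1 / ((real n - 1) * real n ^ i)"
  proof (induction i)
    case (Suc i)
    \<comment> \<open>Telescoping identity for the remainder term, used with
      \<open>x = n ^ i\<close> and \<open>y = n - 1\<close>.\<close>
    have "1 / (y * x) = 1 / ((y + 1) * x) + 1 / (y * ((y + 1) * x))" if "0 < x" "0 < y" for x y :: real
      using that by (simp add: divide_simps add_pos_pos)
    from this[of "real n ^ i" "real n - 1"] show ?case using Suc assms by simp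
  qed simp
  then show ?thesis using assms by simp
qed

lemma greedy_factor_nonneg:
  assumes "2 \<le> n"
  shows "0 \<le> 1 - (\<Sum>j=1..i. 1 / real n ^ j)"
proof -
  have "1 / (real n - 1) \<le> 1" using assms by simp
  then show ?thesis using geometric_sum_less[OF assms, of i] by linarith
qed

text \<open>For \<open>k = 2\<close> both sides equal \<open>(n - 1) / n\<close>. Passing from
  \<open>k\<close> to \<open>k + 1\<close> multiplies the left side by
  \<open>(n - k) / (n - k + 1)\<close>, which is at most \<open>(n - 2) / (n - 1)\<close>, and the
  right side by a factor strictly above \<open>(n - 2) / (n - 1)\<close>. Hence strictness appears
  from 3 on, and the weak inequality is what the induction carries.\<close>

lemma greedy_bound_ge:
  assumes "2 \<le> k" "k \<le> n" "2 \<le> n"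
  shows "(real n - real k + 1) / real n \<le> greedy_bound n k
    \<and> (3 \<le> k \<longrightarrow> (real n - real k + 1) / real n < greedy_bound n k)"
  using assms(1,2)
proof (induction k rule: dec_induct)
  case base
  have "{..<2} = {0, 1::nat}" by auto
  then show ?case using assms by (simp add: greedy_bound_def field_simps)
next
  case (step k)
  define c where "c = 1 - (\<Sum>j=1..k. 1 / real n ^ j)"
  have c: "(real n - 2) / (real n - 1) < c"
    using geometric_sum_less[OF assms(3), of k] assms by (simp add: c_def field_simps)
  have pos: "0 < (real n - real k + 1) / real n" using step assms by auto
  \<comment> \<open>The right side minus the left side is \<open>k - 2\<close>.\<close>
  have "(real n - real k) * (real n - 1) \<le> (real n - real k + 1) * (real n - 2)"
    using step by (simp add: algebra_simps)
  then have "(real n - real k) / real n \<le> (real n - real k + 1) / real n * ((real n - 2) / (real n - 1))"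
    using assms by (simp add: field_simps)
  also have "\<dots> < (real n - real k + 1) / real n * c"
    using c pos by (rule mult_strict_left_mono)
  also have "\<dots> \<le> greedy_bound n k * c"
    using step greedy_factor_nonneg[OF assms(3), of k] by (intro mult_right_mono) (auto simp: c_def)
  also have "\<dots> = greedy_bound n (Suc k)" by (simp add: greedy_bound_def c_def)
  finally show ?case by auto
qed

section \<open>Counting prefix codes with pairwise distinct lengths\<close>

lemma card_words_with_prefix:
  assumes "finite X" "length v \<le> a"
  shows "card {w. set w \<subseteq> X \<and> length w = a \<and> prefix v w} \<le> card X ^ (a - length v)"
proof -
  let ?T = "{u. set u \<subseteq> X \<and> length u = a - length v}"
  have "{w. set w \<subseteq> X \<and> length w = a \<and> prefix v w} \<subseteq> (\<lambda>u. v @ u) ` ?T"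
    by (auto elim!: prefixE)
  then have "card {w. set w \<subseteq> X \<and> length w = a \<and> prefix v w} \<le> card ?T"
    using assms finite_lists_length_eq[of X] by (intro surj_card_le) auto
  then show ?thesis using assms by (simp add: card_lists_length_eq)
qed

text \<open>A union bound: each \<open>v\<close> excludes at most the fraction
  \<open>1 / card X ^ length v\<close> of all words of length \<open>a\<close>.\<close>

lemma card_words_avoiding_prefixes:
  assumes "finite X" "0 < card X" "finite V" "\<forall>v\<in>V. length v \<le> a"
  shows "real (card X) ^ a * (1 - (\<Sum>v\<in>V. 1 / real (card X) ^ length v))
    \<le> real (card {w. set w \<subseteq> X \<and> length w = a \<and> (\<forall>v\<in>V. \<not> prefix v w)})"
proof -
  let ?n = "card X"
  let ?W = "{w. set w \<subseteq> X \<and> length w = a}"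
  let ?P = "\<lambda>v. {w. set w \<subseteq> X \<and> length w = a \<and> prefix v w}"
  let ?G = "{w. set w \<subseteq> X \<and> length w = a \<and> (\<forall>v\<in>V. \<not> prefix v w)}"
  have fW: "finite ?W" using assms finite_lists_length_eq by blast
  have W: "?W = ?G \<union> (\<Union>v\<in>V. ?P v)" by auto
  have "?n ^ a = card ?W" using assms by (simp add: card_lists_length_eq)
  also have "\<dots> \<le> card ?G + card (\<Union>v\<in>V. ?P v)" by (subst W) (rule card_Un_le)
  also have "card (\<Union>v\<in>V. ?P v) \<le> (\<Sum>v\<in>V. card (?P v))" using assms by (intro card_UN_le) auto
  also have "\<dots> \<le> (\<Sum>v\<in>V. ?n ^ (a - length v))"
    using assms by (intro sum_mono card_words_with_prefix) auto
  finally have "real (?n ^ a) \<le> real (card ?G + (\<Sum>v\<in>V. ?n ^ (a - length v)))"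
    by (simp only: of_nat_le_iff)
  moreover have "(\<Sum>v\<in>V. real ?n ^ (a - length v)) = real ?n ^ a * (\<Sum>v\<in>V. 1 / real ?n ^ length v)"
  proof -
    have nz: "real ?n \<noteq> 0" using assms(2) by simp
    have "real ?n ^ (a - length v) = real ?n ^ a * (1 / real ?n ^ length v)" if "v \<in> V" for v
      using power_diff[OF nz, of "length v" a] assms(4) that by simp
    then show ?thesis unfolding sum_distrib_left by (intro sum.cong) auto
  qed
  ultimately show ?thesis by (simp add: algebra_simps)
qed

text \<open>An index-free form, so that inserting a word in the middle of a code causes no index
  shifts.\<close>

lemma prefix_code_iff:
  "prefix_code vs \<longleftrightarrow> distinct vs \<and> [] \<notin> set vs \<and>
    (\<forall>u\<in>set vs. \<forall>v\<in>set vs. u \<noteq> v \<longrightarrow> \<not> prefix u v)"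
  unfolding prefix_code_def by (metis in_set_conv_nth nth_eq_iff_index_eq)

text \<open>A strictly longer word is neither equal to an old word nor a prefix of one, so only one
  direction of the prefix condition has to be assumed. The insertion position is arbitrary because
  length distributions are not sorted.\<close>

lemma prefix_code_insert_longest:
  assumes "prefix_code (us @ vs)" "w \<noteq> []"
    and "\<forall>v\<in>set (us @ vs). length v < length w \<and> \<not> prefix v w"
  shows "prefix_code (us @ w # vs)"
proof -
  have "\<not> prefix w v" if "v \<in> set (us @ vs)" for v
    using assms(3) that prefix_length_le by fastforce
  moreover have "w \<notin> set (us @ vs)" using assms(3) by auto
  ultimately show ?thesis using assms unfolding prefix_code_iff by auto
qed

lemma finite_PR: "finite X \<Longrightarrow> finite (PR X L)"
  by (rule finite_subset[OF _ finite_codes]) (auto simp: PR_def)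

lemma finite_UD: "finite X \<Longrightarrow> finite (UD X L)"
  by (rule finite_subset[OF _ finite_codes]) (auto simp: UD_def)

text \<open>Concatenation is injective here, since the prescribed lengths tell where to cut.\<close>

lemma card_UD_le:
  assumes "finite X"
  shows "card (UD X L) \<le> card X ^ sum_list L"
proof -
  have "inj_on concat (UD X L)"
  proof (rule inj_onI)
    fix us vs assume "us \<in> UD X L" "vs \<in> UD X L" "concat us = concat vs"
    moreover from this have len: "map length us = map length vs" by (simp add: UD_def codes_def)
    moreover have "length (us ! i) = length (vs ! i)" if "i < length us" for i
      using that len by (metis length_map nth_map)
    ultimately show "us = vs"
      by (intro concat_injective) (auto simp: set_zip dest: map_eq_imp_length_eq)
  qed
  moreover have "concat ` UD X L \<subseteq> {w. set w \<subseteq> X \<and> length w = sum_list L}"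
    by (fastforce simp: UD_def codes_def length_concat lists_eq_set)
  ultimately have "card (UD X L) \<le> card {w. set w \<subseteq> X \<and> length w = sum_list L}"
    using assms finite_lists_length_eq by (intro card_inj_on_le) auto
  then show ?thesis using assms by (simp add: card_lists_length_eq)
qed

text \<open>Each prefix code for the other lengths extends by any word of length \<open>a\<close>
  that avoids its words as prefixes. Distinct pairs of a code and such a word give distinct extended
  codes, and the union bound counts the admissible words.\<close>

lemma card_PR_insert_max:
  assumes "finite X" "2 \<le> card X" "distinct (L1 @ a # L2)"
    and "\<forall>b\<in>set (L1 @ L2). 0 < b \<and> b < a" "0 < a"
  shows "real (card (PR X (L1 @ L2))) * (real (card X) ^ a *
      (1 - (\<Sum>j=1..length (L1 @ L2). 1 / real (card X) ^ j)))
    \<le> real (card (PR X (L1 @ a # L2)))"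
proof -
  let ?L = "L1 @ L2" and ?n = "card X" and ?k = "length L1"
  let ?c = "real ?n ^ a * (1 - (\<Sum>j=1..length ?L. 1 / real ?n ^ j))"
  let ?G = "\<lambda>vs. {w. set w \<subseteq> X \<and> length w = a \<and> (\<forall>v\<in>set vs. \<not> prefix v w)}"
  let ?F = "\<lambda>(vs, w). take ?k vs @ w # drop ?k vs"
  have fG: "finite (?G vs)" for vs
    by (rule finite_subset[OF _ finite_lists_length_eq[OF assms(1), of a]]) auto
  have c: "?c \<le> real (card (?G vs))" if vs: "vs \<in> PR X ?L" for vs
  proof -
    have len: "map length vs = ?L" and "distinct vs"
      using vs by (auto simp: PR_def codes_def prefix_code_def)
    have "length v \<in> set ?L" if "v \<in> set vs" for v using that len by (metis imageI set_map)
    then have "\<forall>v\<in>set vs. length v \<le> a" using assms(4) by (meson less_imp_le)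
    then have 1: "real ?n ^ a * (1 - (\<Sum>v\<in>set vs. 1 / real ?n ^ length v)) \<le> real (card (?G vs))"
      using assms by (intro card_words_avoiding_prefixes) auto
    \<comment> \<open>Both the words and their lengths are pairwise distinct, so the sum over words
      becomes a sum over a set of positive integers, which is largest for an initial
      segment.\<close>
    have "(\<Sum>v\<in>set vs. 1 / real ?n ^ length v) = (\<Sum>b\<leftarrow>map length vs. 1 / real ?n ^ b)"
      using \<open>distinct vs\<close> by (simp add: sum_list_distinct_conv_sum_set o_def)
    also have "\<dots> = (\<Sum>b\<in>set ?L. 1 / real ?n ^ b)"
      unfolding len using assms(3) by (intro sum_list_distinct_conv_sum_set) auto
    also have "\<dots> \<le> (\<Sum>j=1..card (set ?L). 1 / real ?n ^ j)"
      using assms by (intro sum_antimono_le_initial_segment)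
        (auto intro!: antimonoI divide_left_mono power_increasing)
    also have "card (set ?L) = length ?L" using assms(3) by (intro distinct_card) auto
    finally have "?c \<le> real ?n ^ a * (1 - (\<Sum>v\<in>set vs. 1 / real ?n ^ length v))"
      by (intro mult_left_mono) auto
    then show ?thesis using 1 by linarith
  qed
  have "inj_on ?F (Sigma (PR X ?L) ?G)"
  proof (rule inj_onI, clarify)
    fix us u vs v
    assume "us \<in> PR X ?L" "vs \<in> PR X ?L"
      and eq: "take ?k us @ u # drop ?k us = take ?k vs @ v # drop ?k vs"
    then have "map length us = ?L" "map length vs = ?L" by (auto simp: PR_def codes_def)
    then have "length us = length ?L" "length vs = length ?L" by (metis length_map)+
    then show "us = vs \<and> u = v" using eq by (metis append_eq_append_conv append_take_drop_id length_take list.inject)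
  qed
  moreover have "?F ` Sigma (PR X ?L) ?G \<subseteq> PR X (L1 @ a # L2)"
  proof clarify
    fix vs w
    assume vs: "vs \<in> PR X ?L" and w: "set w \<subseteq> X" "a = length w" "\<forall>v\<in>set vs. \<not> prefix v w"
    have len: "map length vs = ?L" using vs by (auto simp: PR_def codes_def)
    have "length v \<in> set ?L" if "v \<in> set vs" for v using that len by (metis imageI set_map)
    then have "\<forall>v\<in>set vs. length v < length w" using assms(4) w(2) by metis
    then have "prefix_code (take ?k vs @ w # drop ?k vs)"
      using vs w assms(5) by (intro prefix_code_insert_longest)
        (auto simp: PR_def dest: in_set_takeD in_set_dropD)
    moreover have "map length (take ?k vs @ w # drop ?k vs) = L1 @ length w # L2"
      using len by (simp flip: take_map drop_map)
    moreover have "take ?k vs @ w # drop ?k vs \<in> lists (lists X)"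
      using vs w by (auto simp: PR_def codes_def dest: in_set_takeD in_set_dropD)
    ultimately show "take ?k vs @ w # drop ?k vs \<in> PR X (L1 @ length w # L2)"
      by (simp add: PR_def codes_def)
  qed
  ultimately have "card (Sigma (PR X ?L) ?G) \<le> card (PR X (L1 @ a # L2))"
    using finite_PR[OF assms(1)] by (intro card_inj_on_le)
  moreover have "card (Sigma (PR X ?L) ?G) = (\<Sum>vs\<in>PR X ?L. card (?G vs))"
    using finite_PR[OF assms(1)] fG by (intro card_SigmaI) auto
  moreover have "(\<Sum>vs\<in>PR X ?L. ?c) \<le> (\<Sum>vs\<in>PR X ?L. real (card (?G vs)))"
    using c by (intro sum_mono)
  ultimately show ?thesis by (simp flip: of_nat_sum)
qed

text \<open>Induction that removes the largest length: the longest word is chosen last and accounts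
  for the last factor of the product.\<close>

lemma card_PR_ge_greedy_bound:
  assumes "finite X" "2 \<le> card X" "distinct L" "\<forall>a\<in>set L. 0 < a"
  shows "real (card X) ^ sum_list L * greedy_bound (card X) (length L) \<le> real (card (PR X L))"
  using assms(3,4)
proof (induction "length L" arbitrary: L)
  case 0
  then have "PR X L = {[]}" by (auto simp: PR_def codes_def prefix_code_def)
  then show ?case using 0 by (simp add: greedy_bound_def)
next
  case (Suc k)
  define a where "a = Max (set L)"
  have "a \<in> set L" using Suc.hyps(2) unfolding a_def by (intro Max_in) auto
  then obtain L1 L2 where L: "L = L1 @ a # L2" by (meson split_list)
  have lt: "\<forall>b\<in>set (L1 @ L2). 0 < b \<and> b < a"
  proof
    fix b assume b: "b \<in> set (L1 @ L2)"
    then have "b \<noteq> a" "b \<in> set L" using Suc.prems(1) L by auto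
    moreover have "b \<le> a" using \<open>b \<in> set L\<close> by (simp add: a_def)
    ultimately show "0 < b \<and> b < a" using Suc.prems(2) by auto
  qed
  have k: "k = length (L1 @ L2)" using Suc.hyps(2) L by simp
  let ?s = "1 - (\<Sum>j=1..k. 1 / real (card X) ^ j)"
  have "real (card X) ^ sum_list L * greedy_bound (card X) (length L)
      = real (card X) ^ sum_list (L1 @ L2) * greedy_bound (card X) k * (real (card X) ^ a * ?s)"
    unfolding Suc.hyps(2)[symmetric] by (simp add: L greedy_bound_def power_add)
  also have "\<dots> \<le> real (card (PR X (L1 @ L2))) * (real (card X) ^ a * ?s)"
    using Suc.hyps(1)[OF k] Suc.prems greedy_factor_nonneg[OF assms(2), of k]
    by (intro mult_right_mono) (auto simp: L k)
  also have "\<dots> \<le> real (card (PR X L))"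
    unfolding k L using assms lt Suc.prems L \<open>a \<in> set L\<close> by (intro card_PR_insert_max) auto
  finally show ?case .
qed

lemma greedy_bound_le_xi_star:
  assumes "finite X" "2 \<le> m" "m \<le> card X"
  shows "greedy_bound (card X) m \<le> xi_star X m"
  unfolding xi_star_def
proof (rule cINF_greatest)
  have n: "2 \<le> card X" using assms by simp
  \<comment> \<open>The infimum needs a nonempty index set. Positivity of the bound shows that the
    lengths 1 to \<open>m\<close> admit a prefix code.\<close>
  have pos: "0 < greedy_bound (card X) m"
  proof -
    have "0 < (real (card X) - real m + 1) / real (card X)" using assms n by auto
    then show ?thesis using greedy_bound_ge[OF assms(2,3) n] by linarith
  qed
  have "0 < real (card X) ^ sum_list [1..<Suc m] * greedy_bound (card X) (length [1..<Suc m])"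
    using pos n by (simp del: upt_Suc)
  also have "\<dots> \<le> real (card (PR X [1..<Suc m]))"
    using assms n by (intro card_PR_ge_greedy_bound) auto
  finally have "PR X [1..<Suc m] \<noteq> {}" by auto
  then have "[1..<Suc m] \<in> LD_star X m"
    using PR_subset_UD by (fastforce simp: LD_star_def LD_def simp del: upt_Suc)
  then show "LD_star X m \<noteq> {}" by auto
next
  fix L assume "L \<in> LD_star X m"
  then have L: "length L = m" "\<forall>a\<in>set L. 0 < a" "UD X L \<noteq> {}" "distinct L"
    by (auto simp: LD_star_def LD_def)
  have n: "2 \<le> card X" using assms by simp
  have "0 \<le> greedy_bound (card X) m"
    using greedy_factor_nonneg[OF n] unfolding greedy_bound_def by (intro prod_nonneg) auto
  moreover have "real (card (UD X L)) \<le> real (card X) ^ sum_list L"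
    using card_UD_le[OF assms(1), of L] by (metis of_nat_le_iff of_nat_power)
  ultimately have "greedy_bound (card X) m * real (card (UD X L))
      \<le> greedy_bound (card X) m * real (card X) ^ sum_list L"
    by (rule mult_left_mono[rotated])
  also have "\<dots> \<le> real (card (PR X L))"
    using card_PR_ge_greedy_bound[OF assms(1) n L(4,2)] L(1) by (simp add: mult.commute)
  finally have "greedy_bound (card X) m * real (card (UD X L)) \<le> real (card (PR X L))" .
  moreover have "0 < card (UD X L)" using L(3) finite_UD[OF assms(1)] by (simp add: card_gt_0_iff)
  ultimately show "greedy_bound (card X) m \<le> real (card (PR X L)) / real (card (UD X L))"
    by (simp add: pos_le_divide_eq)
qed

section \<open>Codes made of single letters and one long word\<close>

text \<open>If two factorizations first differ where one uses \<open>w\<close> and the other a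
  letter of \<open>bs\<close>, the position of the first letter outside \<open>bs\<close> differs
  between them. Two different letters of \<open>bs\<close> are told apart at once.\<close>

lemma uniquely_decodable_letters_and_word:
  assumes "distinct bs" "\<not> set w \<subseteq> set bs"
  shows "uniquely_decodable (map (\<lambda>x. [x]) bs @ [w])"
proof -
  let ?vs = "map (\<lambda>x. [x]) bs @ [w]" and ?k = "length bs"
  \<comment> \<open>The position, counted from 0, of the first letter outside \<open>bs\<close>, or
    the full length if there is none.\<close>
  let ?t = "\<lambda>xs. length (takeWhile (\<lambda>x. x \<in> set bs) xs)"
  let ?c = "\<lambda>is. concat (map (\<lambda>i. ?vs ! i) is)"
  obtain c where c: "c \<in> set w" "c \<notin> set bs" using assms(2) by auto
  have tw: "?t (w @ xs) = ?t w" for xs using takeWhile_append1[OF c(1)] c(2) by auto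
  have nth: "?vs ! i = (if i = ?k then w else [bs ! i])" if "i < Suc ?k" for i
    using that by (auto simp: nth_append)
  \<comment> \<open>Letters outside \<open>bs\<close> come only from copies of \<open>w\<close>, and
    whatever precedes the first copy can only delay them.\<close>
  have late: "?t w \<le> ?t (?c js)" if "set js \<subseteq> {..<Suc ?k}" "\<not> set (?c js) \<subseteq> set bs" for js
    using that
  proof (induction js)
    case (Cons j js)
    show ?case
    proof (cases "j = ?k")
      case True
      then show ?thesis using tw by (simp add: nth_append)
    next
      case False
      then have j: "?vs ! j = [bs ! j]" "bs ! j \<in> set bs" using Cons.prems nth[of j] by auto
      then show ?thesis using Cons by auto
    qed
  qed simp
  \<comment> \<open>The first letter outside \<open>bs\<close> would occur at two different positions.\<close>
  have clash: False
    if "set js \<subseteq> {..<Suc ?k}" "j < ?k" "w @ xs = [bs ! j] @ ?c js" for xs j js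
  proof -
    have mem: "bs ! j \<in> set bs" using that by simp
    have "c \<in> set ([bs ! j] @ ?c js)" using that(3) c(1) by (metis Un_iff set_append)
    then have "c \<in> set (?c js)" using c(2) mem by auto
    then have "?t w \<le> ?t (?c js)" using late that(1) c(2) by blast
    moreover have "?t w = Suc (?t (?c js))" using tw[of xs] that(3) mem by simp
    ultimately show False by simp
  qed
  have ne: "?vs ! i \<noteq> []" if "i < Suc ?k" for i using nth[OF that] c(1) by auto
  have "is = js"
    if "set is \<subseteq> {..<Suc ?k}" "set js \<subseteq> {..<Suc ?k}" "?c is = ?c js" for "is" js
    using that
  proof (induction "is" arbitrary: js)
    case Nil
    then show ?case using ne by (cases js) auto
  next
    case (Cons i "is")
    then obtain j js' where js: "js = j # js'" using ne by (cases js) auto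
    have ij: "i < Suc ?k" "j < Suc ?k" and sub: "set is \<subseteq> {..<Suc ?k}" "set js' \<subseteq> {..<Suc ?k}"
      using Cons.prems js by auto
    have eq: "?vs ! i @ ?c is = ?vs ! j @ ?c js'" using Cons.prems js by simp
    have "i = j"
    proof (rule ccontr)
      assume "i \<noteq> j"
      then consider "i = ?k" "j < ?k" | "j = ?k" "i < ?k" | "i < ?k" "j < ?k" using ij by linarith
      then show False
      proof cases
        case 1
        then show False using clash[OF sub(2), of j "?c is"] eq nth[OF ij(1)] nth[OF ij(2)] by simp
      next
        case 2
        then show False using clash[OF sub(1), of i "?c js'"] eq nth[OF ij(1)] nth[OF ij(2)] by simp
      next
        case 3
        then have "bs ! i = bs ! j" using eq nth[OF ij(1)] nth[OF ij(2)] by simp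
        then show False using 3 \<open>i \<noteq> j\<close> assms(1) by (simp add: nth_eq_iff_index_eq)
      qed
    qed
    then show ?case using Cons.IH[OF sub] eq js by auto
  qed
  then show ?thesis unfolding uniquely_decodable_def by simp
qed

text \<open>These are the choices of the one-letter code words. Their number is never computed: it
  is a common factor of the two counts below and cancels once known to be positive.\<close>

definition distinct_words :: "'a set \<Rightarrow> nat \<Rightarrow> 'a list set" where
  "distinct_words X k = {bs. length bs = k \<and> distinct bs \<and> set bs \<subseteq> X}"

lemma finite_distinct_words: "finite X \<Longrightarrow> finite (distinct_words X k)"
  by (rule finite_subset[OF _ finite_lists_length_eq[of X k]]) (auto simp: distinct_words_def)

text \<open>Once the letters \<open>bs\<close> are fixed, every word not written entirely over
  \<open>bs\<close> may serve as the last code word.\<close>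

lemma card_UD_ones_ge:
  assumes "finite X"
  shows "card (distinct_words X k) * (card X ^ a - k ^ a) \<le> card (UD X (replicate k 1 @ [a]))"
proof -
  let ?D = "distinct_words X k"
  let ?W = "\<lambda>A. {w. set w \<subseteq> A \<and> length w = a}"
  let ?F = "\<lambda>(bs, w). map (\<lambda>x. [x]) bs @ [w]"
  have card: "card (?W X - ?W (set bs)) = card X ^ a - k ^ a" if "bs \<in> ?D" for bs
  proof -
    have bs: "set bs \<subseteq> X" "card (set bs) = k"
      using that by (auto simp: distinct_words_def distinct_card)
    then show ?thesis using assms finite_lists_length_eq[of "set bs" a]
      by (subst card_Diff_subset) (auto simp: card_lists_length_eq)
  qed
  have "inj_on ?F (Sigma ?D (\<lambda>bs. ?W X - ?W (set bs)))"
    by (rule inj_onI) (auto simp: map_eq_conv inj_map_eq_map inj_on_def)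
  moreover have "?F ` Sigma ?D (\<lambda>bs. ?W X - ?W (set bs)) \<subseteq> UD X (replicate k 1 @ [a])"
  proof
    fix vs assume "vs \<in> ?F ` Sigma ?D (\<lambda>bs. ?W X - ?W (set bs))"
    then obtain bs w where vs: "vs = map (\<lambda>x. [x]) bs @ [w]" and bs: "bs \<in> ?D"
      and w: "set w \<subseteq> X" "length w = a" "\<not> set w \<subseteq> set bs" by clarsimp blast
    then have "uniquely_decodable vs"
      using uniquely_decodable_letters_and_word by (auto simp: distinct_words_def)
    then show "vs \<in> UD X (replicate k 1 @ [a])"
      using vs bs w by (auto simp: UD_def codes_def distinct_words_def o_def map_replicate_const lists_eq_set)
  qed
  ultimately have "card (Sigma ?D (\<lambda>bs. ?W X - ?W (set bs))) \<le> card (UD X (replicate k 1 @ [a]))"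
    using finite_UD[OF assms] by (intro card_inj_on_le)
  moreover have "card (Sigma ?D (\<lambda>bs. ?W X - ?W (set bs))) = (\<Sum>bs\<in>?D. card (?W X - ?W (set bs)))"
    using finite_distinct_words[OF assms] finite_lists_length_eq[OF assms]
    by (intro card_SigmaI) auto
  ultimately show ?thesis using card by simp
qed

text \<open>The prefix condition forces the first letter of the last word to avoid the
  \<open>k\<close> chosen letters and leaves its other \<open>a\<close> letters free.\<close>

lemma card_PR_ones_le:
  assumes "finite X"
  shows "card (PR X (replicate k 1 @ [Suc a])) \<le> card (distinct_words X k) * ((card X - k) * card X ^ a)"
proof -
  let ?D = "distinct_words X k" and ?W = "{w. set w \<subseteq> X \<and> length w = a}"
  let ?S = "Sigma ?D (\<lambda>bs. (X - set bs) \<times> ?W)"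
  let ?F = "\<lambda>(bs, x, w). map (\<lambda>x. [x]) bs @ [x # w]"
  have fW: "finite ?W" using finite_lists_length_eq[OF assms] .
  have "PR X (replicate k 1 @ [Suc a]) \<subseteq> ?F ` ?S"
  proof
    fix vs assume vs: "vs \<in> PR X (replicate k 1 @ [Suc a])"
    then have "map length vs = replicate k 1 @ [Suc a]" by (simp add: PR_def codes_def)
    then obtain us y where us: "vs = us @ [y]" "map length us = replicate k 1" "length y = Suc a"
      by (auto simp: map_eq_append_conv)
    obtain x w where y: "y = x # w" using us(3) by (cases y) auto
    define bs where "bs = map hd us"
    have "\<forall>u\<in>set us. length u = 1"
      using us(2) by (metis imageI in_set_replicate set_map)
    then have "map (\<lambda>u. [hd u]) us = us" by (intro map_idI) (auto simp: length_Suc_conv)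
    then have map: "us = map (\<lambda>x. [x]) bs" by (simp add: bs_def o_def)
    have vsF: "vs = ?F (bs, x, w)" using us(1) map y by simp
    have pc: "prefix_code (map (\<lambda>x. [x]) bs @ [x # w])" using vs vsF by (simp add: PR_def)
    have "length bs = k" using us(2) by (metis bs_def length_map length_replicate)
    moreover have "distinct bs" using pc by (auto simp: prefix_code_iff distinct_map)
    moreover have "set bs \<subseteq> X" "x \<in> X" "set w \<subseteq> X" "length w = a"
      using vs vsF us(3) y by (auto simp: PR_def codes_def)
    moreover have "x \<notin> set bs"
    proof
      assume x: "x \<in> set bs"
      then have "[x] \<in> set (map (\<lambda>x. [x]) bs)" by auto
      \<comment> \<open>The prefix condition only compares different words. If \<open>w\<close> is
        empty, distinctness of the code is what excludes equality.\<close>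
      moreover from this have "[x] \<noteq> x # w" using pc by (auto simp: prefix_code_iff)
      ultimately have "\<not> prefix [x] (x # w)" using pc unfolding prefix_code_iff by auto
      then show False by simp
    qed
    ultimately have "(bs, x, w) \<in> ?S" by (auto simp: distinct_words_def)
    then show "vs \<in> ?F ` ?S" using vsF by blast
  qed
  then have "card (PR X (replicate k 1 @ [Suc a])) \<le> card ?S"
    using finite_distinct_words[OF assms] assms fW by (intro surj_card_le) auto
  also have "card ?S = (\<Sum>bs\<in>?D. card ((X - set bs) \<times> ?W))"
    using finite_distinct_words[OF assms] assms fW by (intro card_SigmaI) auto
  also have "\<dots> = (\<Sum>bs\<in>?D. (card X - k) * card X ^ a)"
  proof (rule sum.cong)
    fix bs assume "bs \<in> ?D"
    then show "card ((X - set bs) \<times> ?W) = (card X - k) * card X ^ a"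
      using assms by (auto simp: distinct_words_def card_cartesian_product card_lists_length_eq
          card_Diff_subset distinct_card)
  qed simp
  finally show ?thesis by simp
qed

text \<open>The quotient of the two counts is \<open>q / (1 - r ^ Suc a)\<close> with
  \<open>r < 1\<close>, so letting \<open>a\<close> grow leaves \<open>q\<close>.\<close>

lemma xi_le:
  assumes "finite X" "k < card X"
  shows "xi X (Suc k) \<le> (real (card X) - real k) / real (card X)"
proof -
  let ?n = "card X"
  define r where "r = real k / real ?n"
  define q where "q = (real ?n - real k) / real ?n"
  have r: "0 \<le> r" "r < 1" using assms by (auto simp: r_def)
  have "xi X (Suc k) \<le> q / (1 - r ^ Suc a)" for a
  proof -
    let ?L = "replicate k 1 @ [Suc a]"
    define d where "d = card (distinct_words X k)"
    \<comment> \<open>Here \<open>k < card X\<close> provides \<open>k\<close> distinct letters.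
      Positivity of \<open>d\<close> makes the denominator positive and allows cancelling.\<close>
    have "0 < d"
    proof -
      obtain B where "B \<subseteq> X" "card B = k" "finite B"
        using assms by (metis less_imp_le obtain_subset_with_card_n)
      then obtain bs where "set bs = B" "distinct bs" using finite_distinct_list by metis
      then have "bs \<in> distinct_words X k"
        using \<open>B \<subseteq> X\<close> \<open>card B = k\<close> by (auto simp: distinct_words_def distinct_card)
      then show ?thesis using finite_distinct_words[OF assms(1)] by (auto simp: d_def card_gt_0_iff)
    qed
    have pow: "k ^ Suc a < ?n ^ Suc a" using assms by (intro power_strict_mono) auto
    then have pos: "0 < d * (?n ^ Suc a - k ^ Suc a)" using \<open>0 < d\<close> by simp
    have UD: "d * (?n ^ Suc a - k ^ Suc a) \<le> card (UD X ?L)"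
      unfolding d_def by (rule card_UD_ones_ge[OF assms(1)])
    then have "UD X ?L \<noteq> {}" using pos by (metis card.empty not_le)
    then have "?L \<in> LD X (Suc k)" by (auto simp: LD_def)
    then have "xi X (Suc k) \<le> real (card (PR X ?L)) / real (card (UD X ?L))"
      unfolding xi_def by (intro cINF_lower xi_bdd_below)
    also have "\<dots> \<le> real (d * ((?n - k) * ?n ^ a)) / real (d * (?n ^ Suc a - k ^ Suc a))"
      using card_PR_ones_le[OF assms(1), of k a] UD pos
      by (intro frac_le) (simp_all only: d_def of_nat_le_iff of_nat_0_le_iff of_nat_0_less_iff)
    also have "\<dots> = ((real ?n - real k) * real ?n ^ a) / (real ?n ^ Suc a - real k ^ Suc a)"
      using \<open>0 < d\<close> assms pow by (simp add: of_nat_diff less_imp_le del: power_Suc)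
    also have "\<dots> = q / (1 - r ^ Suc a)"
    proof -
      have nz: "real ?n \<noteq> 0" using assms by linarith
      then have "real ?n ^ Suc a - real k ^ Suc a = real ?n ^ Suc a * (1 - r ^ Suc a)"
        unfolding r_def power_divide right_diff_distrib by simp
      moreover have "(real ?n - real k) * real ?n ^ a = real ?n ^ Suc a * q"
        using nz by (simp add: q_def)
      moreover have "real ?n ^ Suc a \<noteq> 0" using nz by simp
      ultimately show ?thesis by (metis mult_divide_mult_cancel_left)
    qed
    finally show ?thesis .
  qed
  moreover have "(\<lambda>a. q / (1 - r ^ Suc a)) \<longlonglongrightarrow> q / (1 - 0)"
    using r by (intro tendsto_intros LIMSEQ_Suc LIMSEQ_realpow_zero) auto
  ultimately show ?thesis
    unfolding q_def[symmetric] by (intro LIMSEQ_le_const) auto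
qed

theorem corollary3:
  fixes X :: "'a set" and n m :: nat
  assumes "finite X" and "card X = n"
    and "n \<ge> m" and "m \<ge> 3"
  shows "xi_star X m > xi X m"
proof -
  \<comment> \<open>The upper bound is used with \<open>m - 1\<close> one-letter words and one long
    word.\<close>
  have "xi X m = xi X (Suc (m - 1))" using assms by simp
  also have "\<dots> \<le> (real n - real (m - 1)) / real n"
    using xi_le[of X "m - 1"] assms by simp
  also have "\<dots> = (real n - real m + 1) / real n" using assms by (simp add: of_nat_diff)
  \<comment> \<open>The only strict link of the chain, and the place where \<open>m \<ge> 3\<close>
    is essential: for \<open>m = 2\<close> the two sides agree.\<close>
  also have "\<dots> < greedy_bound n m" using greedy_bound_ge[of m n] assms by auto
  also have "\<dots> \<le> xi_star X m" using greedy_bound_le_xi_star[of X m] assms by auto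
  finally show ?thesis .
qed

end
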